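(* Let $\mu>\frac12$, $0<q<1$, $n\in\mathbb{N}$, $M>0$ and $0<\nu\le1$. Then for every $f\in Lip_M(\nu)$ and every $x\in[0,\infty)$, $$\left|D_{n,q}^*(f;x)-f(x)\right|\le M\left(\lambda_n(x)\right)^{\nu/2},$$ where $\lambda_n(x)=D_{n,q}^*\left((e_1-x)^2;x\right)$.
   Context: For $0<q<1$ and $n\in\mathbb{N}=\{1,2,\dots\}$ let $[n]_q=\frac{1-q^n}{1-q}$. For an integer $k\ge 0$ let $\theta_k=0$ if $k$ is even and $\theta_k=1$ if $k$ is odd. For $\mu>\frac12$ define $\gamma_{\mu,q}(0)=1$ and $\gamma_{\mu,q}(k+1)=\frac{1-q^{2\mu\theta_{k+1}+k+1}}{1-q}\,\gamma_{\mu,q}(k)$ for $k=0,1,2,\dots$, and $$E_{\mu,q}(x)=\sum_{k=0}^\infty \frac{q^{k(k-1)/2}x^k}{\gamma_{\mu,q}(k)},\qquad x\in[0,\infty).$$ The Dunkl $q$-parametric Sz\'asz-Mirakjan operators are, for $f\in C[0,\infty)$, $x\in[0,\infty)$, $n\in\mathbb{N}$, $$D_{n,q}^*(f;x)=\frac{1}{E_{\mu,q}([n]_qx)}\sum_{k=0}^\infty \frac{([n]_qx)^k}{\gamma_{\mu,q}(k)}\,q^{k(k-1)/2}\, f\!\left(\frac{1-q^{2\mu\theta_k+k}}{q^{k-2}(1-q^n)}\right).$$ Here $e_1(t)=t$, so $D_{n,q}^*((e_1-x)^2;x)$ is the operator applied to the function $t\mapsto(t-x)^2$ and evaluated at $x$.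 For $M>0$ and $0<\nu\le1$, $Lip_M(\nu)$ is the set of $f\in C[0,\infty)$ with $|f(\zeta_1)-f(\zeta_2)|\le M|\zeta_1-\zeta_2|^\nu$ for all $\zeta_1,\zeta_2\in[0,\infty)$. *)

theory Defs
  imports Complex_Main
begin

definition q_int :: "real \<Rightarrow> nat \<Rightarrow> real" where
  "q_int q n = (1 - q ^ n) / (1 - q)"

definition theta :: "nat \<Rightarrow> nat" where
  "theta k = (if even k then 0 else 1)"

fun dunkl_gamma :: "real \<Rightarrow> real \<Rightarrow> nat \<Rightarrow> real" where
  "dunkl_gamma \<mu> q 0 = 1"
| "dunkl_gamma \<mu> q (Suc k) =
     (1 - q powr (2 * \<mu> * real (theta (k + 1)) + real k + 1)) / (1 - q) * dunkl_gamma \<mu> q k"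

(* k * (k - 1) div 2 is exact on nat: the product is even, and it is 0 for k = 0
   despite truncated subtraction. *)
definition dunkl_exp :: "real \<Rightarrow> real \<Rightarrow> real \<Rightarrow> real" where
  "dunkl_exp \<mu> q x = (\<Sum>k. q ^ (k * (k - 1) div 2) * x ^ k / dunkl_gamma \<mu> q k)"

(* The exponent k - 2 is an integer, negative for k = 0 and k = 1. *)
definition szasz_node :: "real \<Rightarrow> real \<Rightarrow> nat \<Rightarrow> nat \<Rightarrow> real" where
  "szasz_node \<mu> q n k =
     (1 - q powr (2 * \<mu> * real (theta k) + real k)) / (q powi (int k - 2) * (1 - q ^ n))"

(* Functions on [0, infinity) are represented by total functions; for 0 < q < 1, \<mu> > 1/2 and
   n >= 1 the operator evaluates f only at nonnegative nodes.  The series converges whenever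
   f grows at most polynomially, in particular for Lipschitz-class f and for (e_1 - x)^2. *)
definition dunkl_szasz :: "real \<Rightarrow> real \<Rightarrow> nat \<Rightarrow> (real \<Rightarrow> real) \<Rightarrow> real \<Rightarrow> real" where
  "dunkl_szasz \<mu> q n f x =
     1 / dunkl_exp \<mu> q (q_int q n * x) *
     (\<Sum>k. (q_int q n * x) ^ k / dunkl_gamma \<mu> q k * q ^ (k * (k - 1) div 2)
            * f (szasz_node \<mu> q n k))"

definition Lip :: "real \<Rightarrow> real \<Rightarrow> (real \<Rightarrow> real) set" where
  "Lip M \<nu> = {f. continuous_on {0..} f \<and>
     (\<forall>s\<in>{0..}. \<forall>t\<in>{0..}. \<bar>f s - f t\<bar> \<le> M * \<bar>s - t\<bar> powr \<nu>)}"

definition szasz_lambda :: "real \<Rightarrow> real \<Rightarrow> nat \<Rightarrow> real \<Rightarrow> real" where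
  "szasz_lambda \<mu> q n x = dunkl_szasz \<mu> q n (\<lambda>t. (t - x)\<^sup>2) x"

end

theory Submission
  imports Defs "HOL-Analysis.Convex"
begin

text \<open>The operator averages the values of \<open>f\<close> at the nodes against a probability distribution on
  the naturals, so the Lipschitz condition bounds the error by \<open>M\<close> times the mean of
  \<open>\<bar>t - x\<bar>\<^sup>\<nu> = ((t - x)\<^sup>2)\<^bsup>\<nu>/2\<^esup>\<close>. Jensen's inequality for the concave function
  \<open>u \<mapsto> u\<^bsup>\<nu>/2\<^esup>\<close> moves the mean inside. All series converge because the
  Gaussian factor \<open>q\<^bsup>k(k-1)/2\<^esup>\<close> beats the growth of the squared nodes, which is of order \<open>q\<^bsup>-2k\<^esup>\<close>.\<close>

text \<open>The right-hand side is the tangent line at \<open>L\<close> of the concave map taking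
  \<open>u\<close> to \<open>u powr p\<close>. It comes from the weighted Young inequality for
  \<open>u / L\<close> and 1, rescaled by \<open>L powr p\<close>.\<close>

lemma powr_le_tangent:
  fixes u L p :: real
  assumes "u \<ge> 0" "L > 0" "0 < p" "p \<le> 1"
  shows "u powr p \<le> L powr p * (1 - p) + L powr p * p / L * u"
proof (cases "u = 0")
  case True
  then show ?thesis using assms by simp
next
  case False
  have "(u / L) powr p * 1 powr (1 - p) \<le> p * (u / L) + (1 - p) * 1"
    by (rule Youngs_inequality_0) (use assms False in auto)
  then have "u powr p / L powr p \<le> p * (u / L) + (1 - p)"
    using assms by (simp add: powr_divide)
  then have "u powr p \<le> (p * (u / L) + (1 - p)) * L powr p"
    using assms by (simp add: pos_divide_le_eq)
  then show ?thesis by (simp add: algebra_simps)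
qed

text \<open>Averaging the tangent at the mean \<open>L\<close> against \<open>w\<close> yields
  exactly \<open>L powr p\<close>. The same majorant gives summability, so Jensen holds for the
  infinite series without passing through finite sums.\<close>

lemma jensen_powr_series:
  fixes w u :: "nat \<Rightarrow> real" and p :: real
  assumes "\<And>k. w k \<ge> 0" "\<And>k. u k \<ge> 0" "0 < p" "p \<le> 1"
    and w: "w sums 1" and wu: "summable (\<lambda>k. w k * u k)"
  shows "summable (\<lambda>k. w k * u k powr p)"
    and "(\<Sum>k. w k * u k powr p) \<le> (\<Sum>k. w k * u k) powr p"
proof -
  define L where "L = (\<Sum>k. w k * u k)"
  have nonneg: "w k * u k \<ge> 0" for k using assms by simp
  have "summable (\<lambda>k. w k * u k powr p) \<and> (\<Sum>k. w k * u k powr p) \<le> L powr p"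
  proof (cases "L = 0")
    \<comment> \<open>There is no tangent at 0. Here a vanishing sum of nonnegative terms forces
      \<open>w k = 0\<close> or \<open>u k = 0\<close> for each \<open>k\<close>, and
      \<open>0 powr p = 0\<close>.\<close>
    case True
    then have "w k * u k = 0" for k
      using suminf_eq_zero_iff[OF wu] nonneg by (simp add: L_def)
    then have "(\<lambda>k. w k * u k powr p) = (\<lambda>_. 0)"
      by (metis mult_eq_0_iff powr_0)
    then show ?thesis by simp
  next
    case False
    have "L \<ge> 0" unfolding L_def by (intro suminf_nonneg wu nonneg)
    with False have L: "L > 0" by simp
    define A where "A = L powr p * (1 - p)"
    define B where "B = L powr p * p / L"
    have le: "w k * u k powr p \<le> A * w k + B * (w k * u k)" for k
      using mult_left_mono[OF powr_le_tangent[OF assms(2) L assms(3,4)] assms(1), of k k]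
      by (simp add: A_def B_def algebra_simps)
    have sums: "(\<lambda>k. A * w k + B * (w k * u k)) sums (A * 1 + B * L)"
      unfolding L_def by (intro sums_add sums_mult w summable_sums wu)
    have sm: "summable (\<lambda>k. w k * u k powr p)"
      by (rule summable_comparison_test'[OF sums_summable[OF sums], of 0])
        (use le assms in auto)
    have "(\<Sum>k. w k * u k powr p) \<le> A * 1 + B * L"
      using suminf_le[OF le sm sums_summable[OF sums]] sums_unique[OF sums] by simp
    also have "\<dots> = L powr p" using L by (simp add: A_def B_def algebra_simps)
    finally show ?thesis using sm by simp
  qed
  then show "summable (\<lambda>k. w k * u k powr p)"
    "(\<Sum>k. w k * u k powr p) \<le> (\<Sum>k. w k * u k) powr p"
    by (auto simp: L_def)
qed

lemma triangle_exp_Suc: "Suc k * (Suc k - 1) div 2 = k * (k - 1) div 2 + k"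
proof (cases k)
  case (Suc m)
  have "Suc k * (Suc k - 1) = k * (k - 1) + k * 2"
    by (simp add: Suc)
  then show ?thesis by simp
qed simp

text \<open>The ratio of consecutive terms has modulus \<open>q ^ k * \<bar>z\<bar>\<close>, which
  tends to 0 for every \<open>z\<close>. Having no restriction on \<open>z\<close> lets geometric
  growth of the nodes be absorbed into it later.\<close>

lemma summable_gaussian_power:
  fixes q z :: real
  assumes "0 < q" "q < 1"
  shows "summable (\<lambda>k. q ^ (k * (k - 1) div 2) * z ^ k)"
proof -
  have "(\<lambda>k. q ^ k * \<bar>z\<bar>) \<longlonglongrightarrow> 0 * \<bar>z\<bar>"
    by (intro tendsto_mult LIMSEQ_power_zero tendsto_const) (use assms in auto)
  then have "eventually (\<lambda>k. q ^ k * \<bar>z\<bar> < 1 / 2) sequentially"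
    by (intro order_tendstoD(2)) auto
  then obtain N where N: "\<And>k. k \<ge> N \<Longrightarrow> q ^ k * \<bar>z\<bar> < 1 / 2"
    by (auto simp: eventually_sequentially)
  show ?thesis
  proof (rule summable_ratio_test[of "1 / 2" N])
    fix k assume "N \<le> k"
    have "norm (q ^ (Suc k * (Suc k - 1) div 2) * z ^ Suc k) =
        (q ^ k * \<bar>z\<bar>) * norm (q ^ (k * (k - 1) div 2) * z ^ k)"
      unfolding triangle_exp_Suc using assms
      by (simp add: power_add abs_mult)
    also have "\<dots> \<le> 1 / 2 * norm (q ^ (k * (k - 1) div 2) * z ^ k)"
      by (rule mult_right_mono[OF less_imp_le[OF N[OF \<open>N \<le> k\<close>]]]) simp
    finally show "norm (q ^ (Suc k * (Suc k - 1) div 2) * z ^ Suc k)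
        \<le> 1 / 2 * norm (q ^ (k * (k - 1) div 2) * z ^ k)" .
  qed simp
qed

text \<open>Every factor is at least 1, because its exponent is at least 1 and \<open>q < 1\<close>.
  Dividing by \<open>dunkl_gamma\<close> therefore never enlarges a nonnegative term.\<close>

lemma dunkl_gamma_ge_1:
  assumes "\<mu> \<ge> 0" "0 < q" "q < 1"
  shows "dunkl_gamma \<mu> q k \<ge> 1"
proof (induction k)
  case (Suc k)
  have "q powr (2 * \<mu> * real (theta (k + 1)) + real k + 1) \<le> q powr 1"
    using assms by (intro powr_mono') auto
  then have "(1 - q powr (2 * \<mu> * real (theta (k + 1)) + real k + 1)) / (1 - q) \<ge> 1"
    using assms by (simp add: le_divide_eq)
  with Suc show ?case
    unfolding dunkl_gamma.simps by (meson mult_ge1_I)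
qed simp

text \<open>The unnormalised probability weights of the operator, with \<open>y\<close> standing for
  \<open>q_int q n * x\<close>.\<close>

definition szasz_weight :: "real \<Rightarrow> real \<Rightarrow> real \<Rightarrow> nat \<Rightarrow> real" where
  "szasz_weight \<mu> q y k = y ^ k / dunkl_gamma \<mu> q k * q ^ (k * (k - 1) div 2)"

lemma szasz_weight_nonneg:
  assumes "\<mu> \<ge> 0" "0 < q" "q < 1" "y \<ge> 0"
  shows "szasz_weight \<mu> q y k \<ge> 0"
  using dunkl_gamma_ge_1[OF assms(1-3), of k] assms by (simp add: szasz_weight_def)

lemma szasz_weight_le:
  assumes "\<mu> \<ge> 0" "0 < q" "q < 1" "y \<ge> 0"
  shows "szasz_weight \<mu> q y k \<le> q ^ (k * (k - 1) div 2) * y ^ k"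
proof -
  have "y ^ k / dunkl_gamma \<mu> q k \<le> y ^ k / 1"
    using dunkl_gamma_ge_1[OF assms(1-3), of k] assms by (intro divide_left_mono) auto
  then show ?thesis
    using mult_right_mono[of _ _ "q ^ (k * (k - 1) div 2)"] assms
    by (fastforce simp: szasz_weight_def mult.commute)
qed

lemma summable_szasz_weight:
  assumes "\<mu> \<ge> 0" "0 < q" "q < 1" "y \<ge> 0"
  shows "summable (szasz_weight \<mu> q y)"
  by (rule summable_comparison_test'[OF summable_gaussian_power[OF assms(2,3), of y], of 0])
    (use szasz_weight_nonneg[OF assms] szasz_weight_le[OF assms] in auto)

lemma dunkl_exp_eq_suminf: "dunkl_exp \<mu> q y = suminf (szasz_weight \<mu> q y)"
  unfolding dunkl_exp_def szasz_weight_def by (rule suminf_cong) simp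

lemma dunkl_exp_pos:
  assumes "\<mu> \<ge> 0" "0 < q" "q < 1" "y \<ge> 0"
  shows "dunkl_exp \<mu> q y > 0"
  unfolding dunkl_exp_eq_suminf
  \<comment> \<open>The term at index 0 equals 1, even for \<open>y = 0\<close>.\<close>
  by (rule suminf_pos2[OF summable_szasz_weight[OF assms], of 0])
    (use szasz_weight_nonneg[OF assms] in \<open>auto simp: szasz_weight_def\<close>)

lemma dunkl_szasz_eq:
  "dunkl_szasz \<mu> q n g x = (\<Sum>k. szasz_weight \<mu> q (q_int q n * x) k * g (szasz_node \<mu> q n k))
     / dunkl_exp \<mu> q (q_int q n * x)"
  by (simp add: dunkl_szasz_def szasz_weight_def)

lemma szasz_node_bounds:
  assumes "\<mu> \<ge> 0" "0 < q" "q < 1" "n \<ge> 1"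
  shows "0 \<le> szasz_node \<mu> q n k" "szasz_node \<mu> q n k \<le> q\<^sup>2 / (1 - q ^ n) * (1 / q) ^ k"
proof -
  have qn: "q ^ n < 1" using assms by (simp add: power_less_one_iff)
  have p: "q powr (2 * \<mu> * real (theta k) + real k) \<le> q powr 0"
    using assms by (intro powr_mono') auto
  \<comment> \<open>Splitting the integer power covers the negative exponents at
    \<open>k = 0\<close> and \<open>k = 1\<close> without a case distinction.\<close>
  have i: "q powi (int k - 2) = q ^ k / q\<^sup>2"
    using assms by (simp add: power_int_diff)
  show "0 \<le> szasz_node \<mu> q n k"
    unfolding szasz_node_def using p qn assms by simp
  have "szasz_node \<mu> q n k \<le> 1 / (q ^ k / q\<^sup>2 * (1 - q ^ n))"
    unfolding szasz_node_def i using qn assms by (intro divide_right_mono) auto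
  then show "szasz_node \<mu> q n k \<le> q\<^sup>2 / (1 - q ^ n) * (1 / q) ^ k"
    by (simp add: power_one_over divide_simps mult_ac)
qed

text \<open>The squared node contributes at most a constant times \<open>(1 / q) ^ (2 * k)\<close>.
  Merged with \<open>y ^ k\<close>, this only replaces \<open>y\<close> by
  \<open>y / q\<^sup>2\<close> in the Gaussian series.\<close>

lemma summable_szasz_weight_second_moment:
  assumes "\<mu> \<ge> 0" "0 < q" "q < 1" "n \<ge> 1" "y \<ge> 0"
  shows "summable (\<lambda>k. szasz_weight \<mu> q y k * (szasz_node \<mu> q n k - x)\<^sup>2)"
proof -
  define C where "C = q\<^sup>2 / (1 - q ^ n)"
  let ?s = "\<lambda>z k. q ^ (k * (k - 1) div 2) * z ^ k"
  have bound: "norm (szasz_weight \<mu> q y k * (szasz_node \<mu> q n k - x)\<^sup>2)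
      \<le> 2 * C\<^sup>2 * ?s (y / q\<^sup>2) k + 2 * x\<^sup>2 * ?s y k" for k
  proof -
    let ?t = "szasz_node \<mu> q n k"
    have "(?t - x)\<^sup>2 \<le> 2 * ?t\<^sup>2 + 2 * x\<^sup>2"
      using zero_le_power2[of "?t + x"] by (simp add: power2_eq_square algebra_simps)
    also have "?t\<^sup>2 \<le> (C * (1 / q) ^ k)\<^sup>2"
      unfolding C_def by (intro power_mono szasz_node_bounds assms)
    finally have t: "(?t - x)\<^sup>2 \<le> 2 * (C * (1 / q) ^ k)\<^sup>2 + 2 * x\<^sup>2"
      by simp
    have "szasz_weight \<mu> q y k * (?t - x)\<^sup>2
        \<le> ?s y k * (2 * (C * (1 / q) ^ k)\<^sup>2 + 2 * x\<^sup>2)"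
      by (rule mult_mono[OF szasz_weight_le t]) (use assms in auto)
    also have "\<dots> = 2 * C\<^sup>2 * ?s (y / q\<^sup>2) k + 2 * x\<^sup>2 * ?s y k"
      by (simp add: power_mult_distrib power_divide algebra_simps flip: power_mult)
    finally show ?thesis
      using szasz_weight_nonneg[OF assms(1-3,5), of k] by simp
  qed
  have "summable (\<lambda>k. 2 * C\<^sup>2 * ?s (y / q\<^sup>2) k + 2 * x\<^sup>2 * ?s y k)"
    by (intro summable_add summable_mult summable_gaussian_power assms)
  then show ?thesis
    by (rule summable_comparison_test') (use bound in auto)
qed

text \<open>Expresses the Lipschitz bound through the squared distance, so that Jensen with exponent
  \<open>\<nu> / 2\<close> produces the second moment.\<close>

lemma Lip_powr_square:
  assumes "f \<in> Lip M \<nu>" "s \<ge> 0" "t \<ge> 0"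
  shows "\<bar>f s - f t\<bar> \<le> M * ((s - t)\<^sup>2) powr (\<nu> / 2)"
proof -
  have "(s - t)\<^sup>2 = \<bar>s - t\<bar> powr 2"
    by simp
  then have "((s - t)\<^sup>2) powr (\<nu> / 2) = \<bar>s - t\<bar> powr \<nu>"
    by (simp only: powr_powr) simp
  then show ?thesis
    using assms by (simp add: Lip_def)
qed

theorem theorem2p6:
  fixes \<mu> q M \<nu> x :: real and n :: nat and f :: "real \<Rightarrow> real"
  assumes "\<mu> > 1 / 2"
    and "0 < q" and "q < 1"
    and "n \<ge> 1"
    and "M > 0"
    and "0 < \<nu>" and "\<nu> \<le> 1"
    and "f \<in> Lip M \<nu>"
    and "x \<ge> 0"
  shows "\<bar>dunkl_szasz \<mu> q n f x - f x\<bar> \<le> M * szasz_lambda \<mu> q n x powr (\<nu> / 2)"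
proof -
  have \<mu>: "\<mu> \<ge> 0" using assms by simp
  define y where "y = q_int q n * x"
  have y: "y \<ge> 0"
    using assms by (simp add: y_def q_int_def power_le_one)
  note params = \<mu> assms(2,3) y
  define t where "t = szasz_node \<mu> q n"
  define E where "E = dunkl_exp \<mu> q y"
  define w where "w k = szasz_weight \<mu> q y k / E" for k
  have E: "E > 0" unfolding E_def by (rule dunkl_exp_pos[OF params])
  have w_nonneg: "w k \<ge> 0" for k
    using szasz_weight_nonneg[OF params] E by (simp add: w_def)
  have "(\<lambda>k. szasz_weight \<mu> q y k / E) sums (E / E)"
    unfolding E_def dunkl_exp_eq_suminf
    by (intro sums_divide summable_sums summable_szasz_weight params)
  then have w_sums: "w sums 1"
    using E by (simp add: w_def[abs_def])
  \<comment> \<open>Summability is required because \<open>suminf\<close> carries no information on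
    a divergent series; under it the normaliser \<open>E\<close> moves inside the sum.\<close>
  have mean: "dunkl_szasz \<mu> q n g x = (\<Sum>k. w k * g (t k))"
    if "summable (\<lambda>k. w k * g (t k))" for g
  proof -
    have "summable (\<lambda>k. szasz_weight \<mu> q y k * g (t k))"
      using summable_mult[OF that, of E] E by (simp add: w_def)
    from suminf_divide[OF this, of E] show ?thesis
      by (simp add: dunkl_szasz_eq w_def t_def E_def y_def)
  qed
  have sq: "summable (\<lambda>k. w k * (t k - x)\<^sup>2)"
    using summable_divide[OF summable_szasz_weight_second_moment[OF \<mu> assms(2-4) y, of x], of E]
    by (simp add: w_def t_def)
  have lam: "szasz_lambda \<mu> q n x = (\<Sum>k. w k * (t k - x)\<^sup>2)"
    unfolding szasz_lambda_def by (rule mean[OF sq])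
  have jensen: "summable (\<lambda>k. w k * ((t k - x)\<^sup>2) powr (\<nu> / 2))"
    "(\<Sum>k. w k * ((t k - x)\<^sup>2) powr (\<nu> / 2)) \<le> szasz_lambda \<mu> q n x powr (\<nu> / 2)"
    unfolding lam using jensen_powr_series[OF w_nonneg _ _ _ w_sums sq, of "\<nu> / 2"] assms by auto
  \<comment> \<open>The class \<open>Lip\<close> controls \<open>f\<close> only on the half-line,
    hence the appeal to nonnegativity of the nodes and of \<open>x\<close>.\<close>
  have bound: "norm (w k * (f (t k) - f x)) \<le> M * (w k * ((t k - x)\<^sup>2) powr (\<nu> / 2))" for k
    using mult_left_mono[OF Lip_powr_square[OF assms(8), of "t k" x] w_nonneg, of k]
      szasz_node_bounds(1)[OF \<mu> assms(2-4), of k] w_nonneg[of k] assms(9)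
    by (simp add: t_def abs_mult mult_ac)
  have dom: "summable (\<lambda>k. M * (w k * ((t k - x)\<^sup>2) powr (\<nu> / 2)))"
    by (rule summable_mult[OF jensen(1)])
  have abs_sm: "summable (\<lambda>k. norm (w k * (f (t k) - f x)))"
    by (rule summable_comparison_test'[OF dom, of 0]) (use bound in auto)
  \<comment> \<open>Since the weights have total mass 1, adding back the constant \<open>f x\<close>
    shows that the series for \<open>f\<close> itself converges, which is what \<open>mean\<close>
    demands.\<close>
  have "(\<lambda>k. w k * (f (t k) - f x) + w k * f x) sums
      ((\<Sum>k. w k * (f (t k) - f x)) + 1 * f x)"
    by (intro sums_add summable_sums summable_norm_cancel[OF abs_sm] sums_mult2 w_sums)
  then have "(\<lambda>k. w k * f (t k)) sums ((\<Sum>k. w k * (f (t k) - f x)) + f x)"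
    by (simp add: algebra_simps)
  then have "dunkl_szasz \<mu> q n f x - f x = (\<Sum>k. w k * (f (t k) - f x))"
    using mean[of f] by (simp add: sums_iff)
  also have "\<bar>\<dots>\<bar> \<le> (\<Sum>k. norm (w k * (f (t k) - f x)))"
    using summable_norm[OF abs_sm] by simp
  also have "\<dots> \<le> (\<Sum>k. M * (w k * ((t k - x)\<^sup>2) powr (\<nu> / 2)))"
    by (rule suminf_le[OF bound abs_sm dom])
  also have "\<dots> = M * (\<Sum>k. w k * ((t k - x)\<^sup>2) powr (\<nu> / 2))"
    by (rule suminf_mult[OF jensen(1)])
  also have "\<dots> \<le> M * szasz_lambda \<mu> q n x powr (\<nu> / 2)"
    using jensen(2) assms(5) by simp
  finally show ?thesis .
qed

end
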